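(* Let $\mathcal{R}$ be a subring of $\mathbb{R}$, $\mathcal{G}\subseteq\mathbb{R}^n$ a sub-module of the $\mathcal{R}$-module $\mathbb{R}^n$, and $\mathcal{C}_\rho=\{(\vec v_k,w_k)\}_{k=1}^m$ a restricted chamfer mask. Then the weighted distance $d_{\mathcal{C}_\rho}$ is a norm on $(\mathcal{G},\mathcal{R})$, i.e. for all $p,q,r\in\mathcal{G}$ and $\lambda\in\mathcal{R}$: $d_{\mathcal{C}_\rho}(p,q)\ge0$; $d_{\mathcal{C}_\rho}(p,q)=0\iff p=q$; $d_{\mathcal{C}_\rho}(p,q)=d_{\mathcal{C}_\rho}(q,p)$; $d_{\mathcal{C}_\rho}(p,q)\le d_{\mathcal{C}_\rho}(p,r)+d_{\mathcal{C}_\rho}(r,q)$; and $d_{\mathcal{C}_\rho}(\lambda p,\lambda q)=|\lambda|\,d_{\mathcal{C}_\rho}(p,q)$.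
   Context: A sub-module of the $\mathcal{R}$-module $\mathbb{R}^n$ is an additive subgroup of $\mathbb{R}^n$ closed under multiplication by elements of $\mathcal{R}$; points and vectors are identified, origin $O=0$. A basis of $(\mathcal{G},\mathcal{R})$ is a family of $n$ vectors of $\mathcal{G}$, linearly independent over $\mathcal{R}$, such that every element of $\mathcal{G}$ is an $\mathcal{R}$-linear combination of them. For a finite set $\mathcal{C}=\{(\vec v_k,w_k)\}\subseteq\mathcal{G}\times\mathcal{R}$: a path from $p$ to $q$ is given by coefficients $\alpha_k\in\mathcal{R}$, $\alpha_k\ge0$, with $\sum_k\alpha_k\vec v_k=q-p$, of cost $\sum_k\alpha_kw_k$; $d_{\mathcal{C}}(p,q)$ is the minimum cost of such paths. The $\mathcal{G}$-sector $\langle\langle\vec u_1,\dots,\vec u_n\rangle\rangle$ of independent vectors is the set of points of $\mathcal{G}$ equal to $\sum_k\lambda_k\vec u_k$ with real $\lambda_k\ge0$; a wedge of $\mathcal{C}$ is such a sector generated by $n$ vectors of $\mathcal{C}$ and containing no other vector of $\mathcal{C}$. A restricted chamfer mask is a finite set $\mathcal{C}_\rho=\{(\vec v_k,w_k)\}_{k=1}^m\subseteq\mathcal{G}\times\mathcal{R}$ such that: (1) $w_k>0$ and $\vec v_k\ne0$ for all $k$; (2) $(\vec v,w)\in\mathcal{C}_\rho\Rightarrow(-\vec v,w)\in\mathcal{C}_\rho$; (3) it is organized in $\mathcal{G}$-basis wedges: its vectors are arranged into a collection of wedges whose generators each form a basis of $(\mathcal{G},\mathcal{R})$, and every $p\in\mathcal{G}$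 can be written $p=\sum_{k=1}^n\alpha_k\vec v_{i_k}$ with $\alpha_k\in\mathcal{R}$, $\alpha_k\ge0$, for the generators of some wedge; (4) the normalized chamfer mask polytope $\mathcal{B}_{\mathcal{C}_\rho}$ — the polytope whose faces are the $(n-1)$-simplices with vertices $\frac{1}{w_{i_1}}\vec v_{i_1},\dots,\frac{1}{w_{i_n}}\vec v_{i_n}$, one per wedge — is convex, i.e. equals its convex hull. *)

theory Defs
  imports "HOL-Analysis.Analysis"
begin

definition real_subring :: "real set \<Rightarrow> bool" where
  "real_subring R \<longleftrightarrow> 1 \<in> R \<and> (\<forall>x\<in>R. \<forall>y\<in>R. x - y \<in> R \<and> x * y \<in> R)"

definition real_submodule :: "real set \<Rightarrow> 'a::real_vector set \<Rightarrow> bool" where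
  "real_submodule R G \<longleftrightarrow>
     0 \<in> G \<and> (\<forall>x\<in>G. \<forall>y\<in>G. x - y \<in> G) \<and> (\<forall>r\<in>R. \<forall>x\<in>G. r *\<^sub>R x \<in> G)"

definition module_basis :: "real set \<Rightarrow> (real^'n) set \<Rightarrow> ('n \<Rightarrow> real^'n) \<Rightarrow> bool" where
  "module_basis R G u \<longleftrightarrow>
     range u \<subseteq> G \<and>
     (\<forall>c. (\<forall>i. c i \<in> R) \<and> (\<Sum>i\<in>UNIV. c i *\<^sub>R u i) = 0 \<longrightarrow> (\<forall>i. c i = 0)) \<and>
     (\<forall>p\<in>G. \<exists>c. (\<forall>i. c i \<in> R) \<and> p = (\<Sum>i\<in>UNIV. c i *\<^sub>R u i))"

definition is_path ::
  "real set \<Rightarrow> ((real^'n) \<times> real) set \<Rightarrow> real^'n \<Rightarrow> real^'n \<Rightarrow> ((real^'n) \<times> real \<Rightarrow> real) \<Rightarrow> bool" where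
  "is_path R C p q \<alpha> \<longleftrightarrow>
     (\<forall>k\<in>C. \<alpha> k \<in> R \<and> 0 \<le> \<alpha> k) \<and> (\<Sum>k\<in>C. \<alpha> k *\<^sub>R fst k) = q - p"

definition path_cost :: "((real^'n) \<times> real) set \<Rightarrow> ((real^'n) \<times> real \<Rightarrow> real) \<Rightarrow> real" where
  "path_cost C \<alpha> = (\<Sum>k\<in>C. \<alpha> k * snd k)"

text \<open>
  The distance is a genuine minimum: on the reals, \<open>LEAST\<close> is unspecified
  unless the set of path costs has a least element.
\<close>

definition weighted_dist ::
  "real set \<Rightarrow> ((real^'n) \<times> real) set \<Rightarrow> real^'n \<Rightarrow> real^'n \<Rightarrow> real" where
  "weighted_dist R C p q = (LEAST c. \<exists>\<alpha>. is_path R C p q \<alpha> \<and> c = path_cost C \<alpha>)"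

definition sector :: "(real^'n) set \<Rightarrow> ('n \<Rightarrow> real^'n) \<Rightarrow> (real^'n) set" where
  "sector G u = {p \<in> G. \<exists>l. (\<forall>i. 0 \<le> l i) \<and> p = (\<Sum>i\<in>UNIV. l i *\<^sub>R u i)}"

text \<open>
  A wedge is represented by the family of weighted vectors that generate it.
  As its coefficients are real, a sector is taken on vectors independent over the reals.
\<close>

definition is_wedge ::
  "(real^'n) set \<Rightarrow> ((real^'n) \<times> real) set \<Rightarrow> ('n \<Rightarrow> (real^'n) \<times> real) \<Rightarrow> bool" where
  "is_wedge G C g \<longleftrightarrow>
     range g \<subseteq> C \<and> inj (fst \<circ> g) \<and> independent (range (fst \<circ> g)) \<and>
     sector G (fst \<circ> g) \<inter> fst ` C \<subseteq> range (fst \<circ> g)"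

definition organized_in_basis_wedges ::
  "real set \<Rightarrow> (real^'n) set \<Rightarrow> ((real^'n) \<times> real) set \<Rightarrow> ('n \<Rightarrow> (real^'n) \<times> real) set \<Rightarrow> bool" where
  "organized_in_basis_wedges R G C W \<longleftrightarrow>
     (\<forall>g\<in>W. is_wedge G C g \<and> module_basis R G (fst \<circ> g)) \<and>
     C \<subseteq> (\<Union>g\<in>W. range g) \<and>
     (\<forall>p\<in>G. \<exists>g\<in>W. \<exists>a. (\<forall>i. a i \<in> R \<and> 0 \<le> a i) \<and> p = (\<Sum>i\<in>UNIV. a i *\<^sub>R fst (g i)))"

definition wedge_face :: "('n \<Rightarrow> (real^'n) \<times> real) \<Rightarrow> (real^'n) set" where
  "wedge_face g = convex hull (range (\<lambda>i. (1 / snd (g i)) *\<^sub>R fst (g i)))"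

text \<open>
  The solid body enclosed by the simplices: the faces together with the points
  that they separate from infinity.
\<close>

definition mask_polytope :: "('n \<Rightarrow> (real^'n) \<times> real) set \<Rightarrow> (real^'n) set" where
  "mask_polytope W = (\<Union>g\<in>W. wedge_face g) \<union> inside (\<Union>g\<in>W. wedge_face g)"

definition restricted_chamfer_mask ::
  "real set \<Rightarrow> (real^'n) set \<Rightarrow> ((real^'n) \<times> real) set \<Rightarrow> bool" where
  "restricted_chamfer_mask R G C \<longleftrightarrow>
     finite C \<and> C \<subseteq> G \<times> R \<and>
     (\<forall>(v, w)\<in>C. 0 < w \<and> v \<noteq> 0) \<and>
     (\<forall>(v, w)\<in>C. (- v, w) \<in> C) \<and>
     (\<exists>W. organized_in_basis_wedges R G C W \<and> convex (mask_polytope W))"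

definition module_norm ::
  "real set \<Rightarrow> 'a::real_vector set \<Rightarrow> ('a \<Rightarrow> 'a \<Rightarrow> real) \<Rightarrow> bool" where
  "module_norm R G d \<longleftrightarrow>
     (\<forall>p\<in>G. \<forall>q\<in>G. 0 \<le> d p q) \<and>
     (\<forall>p\<in>G. \<forall>q\<in>G. d p q = 0 \<longleftrightarrow> p = q) \<and>
     (\<forall>p\<in>G. \<forall>q\<in>G. d p q = d q p) \<and>
     (\<forall>p\<in>G. \<forall>q\<in>G. \<forall>r\<in>G. d p q \<le> d p r + d r q) \<and>
     (\<forall>p\<in>G. \<forall>q\<in>G. \<forall>l\<in>R. d (l *\<^sub>R p) (l *\<^sub>R q) = \<bar>l\<bar> * d p q)"

end

theory Submission imports Defs begin

text \<open>
  The convex hull of the normalized vectors \<open>v / w\<close> lies in the convex polytope. A path to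
  \<open>p \<noteq> 0\<close> of cost \<open>c\<close> puts \<open>p / c\<close> in this hull, and the ray from \<open>p / c\<close> away from the origin
  must meet a face, as otherwise it would connect \<open>p / c\<close> to infinity. This face belongs to a
  wedge that yields a path of cost at most \<open>c\<close>. So only the finitely many wedge paths
  matter and the minimum exists. The argument applies to paths with arbitrary real coefficients,
  which gives homogeneity although \<open>R\<close> need not contain \<open>1 / \<lambda>\<close>.
\<close>

section \<open>Subrings, coefficient families, convex hulls and rays\<close>

lemma real_subring_zero: "real_subring R \<Longrightarrow> 0 \<in> R"
  unfolding real_subring_def by (metis diff_self[of "1::real"])

lemma real_subring_uminus: "real_subring R \<Longrightarrow> x \<in> R \<Longrightarrow> - x \<in> R"
  using real_subring_zero[of R] unfolding real_subring_def by (metis diff_0[of x])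

text \<open>Independence concerns the set \<open>range u\<close>; injectivity lets
  \<open>inv u\<close> carry the indexed coefficients over to it.\<close>

lemma independent_family_coeffs_unique:
  fixes u :: "'n::finite \<Rightarrow> 'a::real_vector"
  assumes "inj u" "independent (range u)"
    and eq: "(\<Sum>i\<in>UNIV. a i *\<^sub>R u i) = (\<Sum>i\<in>UNIV. b i *\<^sub>R u i)"
  shows "a = b"
proof
  fix i
  have "(\<Sum>v\<in>range u. (a (inv u v) - b (inv u v)) *\<^sub>R v) = (\<Sum>i\<in>UNIV. (a i - b i) *\<^sub>R u i)"
    using assms(1) by (simp add: sum.reindex)
  also have "\<dots> = 0"
    using eq by (simp add: scaleR_diff_left sum_subtractf)
  finally have "a (inv u (u i)) - b (inv u (u i)) = 0"
    using independentD[OF assms(2), of "range u" "\<lambda>v. a (inv u v) - b (inv u v)" "u i"] by simp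
  then show "a i = b i"
    using assms(1) by simp
qed

text \<open>The indexed combinations form a convex set containing \<open>range f\<close>, hence
  contain its hull. Weights sit on indices because \<open>f\<close> may repeat values.\<close>

lemma convex_hull_range_coeffs:
  fixes f :: "'n::finite \<Rightarrow> 'a::real_vector"
  assumes "y \<in> convex hull (range f)"
  obtains b where "\<And>i. 0 \<le> b i" "sum b UNIV = 1" "y = (\<Sum>i\<in>UNIV. b i *\<^sub>R f i)"
proof -
  let ?S = "{\<Sum>i\<in>UNIV. b i *\<^sub>R f i | b. (\<forall>i. 0 \<le> b i) \<and> sum b UNIV = 1}"
  have "range f \<subseteq> ?S"
  proof clarify
    fix i
    have "(\<Sum>j\<in>UNIV. (if j = i then 1 else 0) *\<^sub>R f j) = (\<Sum>j\<in>UNIV. if j = i then f j else 0)"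
      by (rule sum.cong) auto
    then show "\<exists>b. f i = (\<Sum>j\<in>UNIV. b j *\<^sub>R f j) \<and> (\<forall>j. 0 \<le> b j) \<and> sum b UNIV = 1"
      by (intro exI[of _ "\<lambda>j. if j = i then 1 else 0"]) simp
  qed
  moreover have "convex ?S"
  proof (rule convexI)
    fix x y and s t :: real
    assume "x \<in> ?S" "y \<in> ?S" and st: "0 \<le> s" "0 \<le> t" "s + t = 1"
    then obtain b c where "\<And>i. 0 \<le> b i" "sum b UNIV = 1" "x = (\<Sum>i\<in>UNIV. b i *\<^sub>R f i)"
      "\<And>i. 0 \<le> c i" "sum c UNIV = 1" "y = (\<Sum>i\<in>UNIV. c i *\<^sub>R f i)"
      by blast
    with st show "s *\<^sub>R x + t *\<^sub>R y \<in> ?S"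
      by (auto intro!: exI[of _ "\<lambda>i. s * b i + t * c i"]
          simp: scaleR_add_left sum.distrib scaleR_sum_right simp flip: sum_distrib_left)
  qed
  ultimately have "y \<in> ?S"
    using assms hull_minimal by blast
  then show ?thesis using that by blast
qed

text \<open>A point of \<open>inside F\<close> has a bounded component in \<open>- F\<close>,
  whereas the outward ray from \<open>y\<close> is connected and unbounded.\<close>

lemma ray_meets_of_mem_inside:
  fixes y :: "'a::real_normed_vector"
  assumes y: "y \<in> F \<union> inside F" "y \<noteq> 0"
  obtains t where "1 \<le> t" "t *\<^sub>R y \<in> F"
proof (cases "y \<in> F")
  case True
  then show ?thesis using that[of 1] by simp
next
  case False
  let ?r = "(\<lambda>t. t *\<^sub>R y) ` {1..}"
  have "\<not> ?r \<subseteq> - F"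
  proof
    assume "?r \<subseteq> - F"
    moreover have "connected ?r"
      by (intro connected_continuous_image continuous_intros) (simp add: convex_connected)
    moreover have "y \<in> ?r"
      by (rule image_eqI[of _ _ 1]) auto
    ultimately have "?r \<subseteq> connected_component_set (- F) y"
      by (intro connected_component_maximal)
    then have "bounded ?r"
      using y(1) False by (auto simp: inside_def intro: bounded_subset)
    then obtain b where b: "\<And>t. 1 \<le> t \<Longrightarrow> norm (t *\<^sub>R y) \<le> b"
      by (auto simp: bounded_iff)
    \<comment> \<open>This parameter is at least 1, and its point on the ray has norm exceeding the
      supposed bound \<open>b\<close>.\<close>
    have "(\<bar>b\<bar> / norm y + 1) * norm y = \<bar>b\<bar> + norm y"
      using y(2) by (simp add: field_simps)
    then have "norm ((\<bar>b\<bar> / norm y + 1) *\<^sub>R y) = \<bar>b\<bar> + norm y"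
      by (simp add: abs_of_nonneg add_nonneg_nonneg)
    moreover have "norm ((\<bar>b\<bar> / norm y + 1) *\<^sub>R y) \<le> b"
      by (rule b) simp
    moreover have "0 < norm y" using y(2) by simp
    ultimately show False by linarith
  qed
  then show ?thesis using that by auto
qed

section \<open>Masks with a fixed collection of wedges\<close>

text \<open>\<open>W\<close> is one witness of the existential in
  \<open>restricted_chamfer_mask\<close>, fixed so that its faces can be named throughout.\<close>

locale organized_mask =
  fixes R :: "real set"
    and G :: "(real^'n) set"
    and C :: "((real^'n) \<times> real) set"
    and W :: "('n \<Rightarrow> (real^'n) \<times> real) set"
  assumes ring: "real_subring R"
    and module: "real_submodule R G"
    and fin: "finite C"
    and weight_pos: "k \<in> C \<Longrightarrow> 0 < snd k"
    and symm: "(v, w) \<in> C \<Longrightarrow> (- v, w) \<in> C"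
    and wedges: "organized_in_basis_wedges R G C W"
    and conv: "convex (mask_polytope W)"
begin

lemma wedge_gen_mem: "g \<in> W \<Longrightarrow> g i \<in> C"
  using wedges unfolding organized_in_basis_wedges_def is_wedge_def by blast

lemma wedge_coeffs_unique:
  assumes "g \<in> W" "(\<Sum>i\<in>UNIV. a i *\<^sub>R fst (g i)) = (\<Sum>i\<in>UNIV. b i *\<^sub>R fst (g i))"
  shows "a = b"
proof (rule independent_family_coeffs_unique)
  show "inj (fst \<circ> g)" "independent (range (fst \<circ> g))"
    using assms(1) wedges by (auto simp: organized_in_basis_wedges_def is_wedge_def)
qed (use assms(2) in simp)

text \<open>The module basis supplies some coefficients in \<open>R\<close>, and independence over
  the reals forces any real ones to agree with them. This is how real arguments return to
  \<open>R\<close>.\<close>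

lemma wedge_coeffs_in_ring:
  assumes "g \<in> W" "(\<Sum>i\<in>UNIV. a i *\<^sub>R fst (g i)) \<in> G"
  shows "a i \<in> R"
proof -
  have "module_basis R G (fst \<circ> g)"
    using assms(1) wedges by (auto simp: organized_in_basis_wedges_def)
  then obtain c where c: "\<And>i. c i \<in> R"
    "(\<Sum>i\<in>UNIV. a i *\<^sub>R fst (g i)) = (\<Sum>i\<in>UNIV. c i *\<^sub>R fst (g i))"
    using assms(2) unfolding module_basis_def by fastforce
  with wedge_coeffs_unique[OF assms(1) c(2)] show ?thesis by simp
qed

lemma finite_wedges: "finite W"
proof (rule finite_subset)
  show "W \<subseteq> PiE UNIV (\<lambda>_. C)"
    using wedge_gen_mem by (auto simp: PiE_def)
qed (use fin in \<open>simp add: finite_PiE\<close>)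

text \<open>Every mask vector generates some wedge, so its normalization is a vertex of a
  face.\<close>

lemma normalized_mem_polytope:
  assumes "k \<in> C"
  shows "(1 / snd k) *\<^sub>R fst k \<in> mask_polytope W"
proof -
  obtain g i where gi: "g \<in> W" "k = g i"
    using assms wedges unfolding organized_in_basis_wedges_def by blast
  then have "(1 / snd k) *\<^sub>R fst k \<in> wedge_face g"
    unfolding wedge_face_def by (auto intro!: hull_inc)
  with gi show ?thesis by (auto simp: mask_polytope_def)
qed

section \<open>Path costs and the polytope\<close>

text \<open>The coefficient set \<open>S\<close> stays arbitrary so that paths over
  \<open>UNIV\<close> are covered as well.\<close>

lemma cost_nonneg: "is_path S C p q \<alpha> \<Longrightarrow> 0 \<le> path_cost C \<alpha>"
  using weight_pos by (force simp: path_cost_def is_path_def intro!: sum_nonneg)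

lemma cost_zero_imp_eq:
  assumes "is_path S C p q \<alpha>" "path_cost C \<alpha> = 0"
  shows "p = q"
proof -
  have "\<forall>k\<in>C. \<alpha> k * snd k = 0"
    using assms weight_pos fin
    by (subst sum_nonneg_eq_0_iff[symmetric])
      (auto simp: path_cost_def is_path_def less_imp_le)
  then have "\<forall>k\<in>C. \<alpha> k = 0"
    using weight_pos by fastforce
  with assms(1) show ?thesis by (simp add: is_path_def)
qed

lemma path_endpoint_mem_polytope:
  assumes path: "is_path S C p q \<alpha>" and "p \<noteq> q"
  shows "(1 / path_cost C \<alpha>) *\<^sub>R (q - p) \<in> mask_polytope W"
proof -
  let ?c = "path_cost C \<alpha>"
  have c: "0 < ?c"
    using cost_nonneg[OF path] cost_zero_imp_eq[OF path] assms(2) by force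
  \<comment> \<open>The shares of the total cost serve as convex weights on the normalized
    vectors.\<close>
  have "(\<Sum>k\<in>C. (\<alpha> k * snd k / ?c) *\<^sub>R ((1 / snd k) *\<^sub>R fst k)) \<in> mask_polytope W"
  proof (rule convex_sum[OF fin conv])
    show "(\<Sum>k\<in>C. \<alpha> k * snd k / ?c) = 1"
      using c by (simp add: path_cost_def flip: sum_divide_distrib)
    show "0 \<le> \<alpha> k * snd k / ?c" if "k \<in> C" for k
      using that path c weight_pos[OF that] by (auto simp: is_path_def)
  qed (rule normalized_mem_polytope)
  moreover have "(\<Sum>k\<in>C. (\<alpha> k * snd k / ?c) *\<^sub>R ((1 / snd k) *\<^sub>R fst k)) =
      (\<Sum>k\<in>C. (1 / ?c) *\<^sub>R (\<alpha> k *\<^sub>R fst k))"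
    using weight_pos by (intro sum.cong) fastforce+
  moreover have "\<dots> = (1 / ?c) *\<^sub>R (q - p)"
    using path unfolding is_path_def by (simp only: scaleR_sum_right[symmetric])
  ultimately show ?thesis by simp
qed

section \<open>Paths within a single wedge\<close>

text \<open>These are the finitely many candidates for the minimum.\<close>

definition wedge_costs :: "real^'n \<Rightarrow> real^'n \<Rightarrow> real set" where
  "wedge_costs p q = {\<Sum>i\<in>UNIV. a i * snd (g i) | g a. g \<in> W \<and>
     (\<forall>i. a i \<in> R \<and> 0 \<le> a i) \<and> (\<Sum>i\<in>UNIV. a i *\<^sub>R fst (g i)) = q - p}"

lemma finite_wedge_costs: "finite (wedge_costs p q)"
proof -
  \<comment> \<open>Ring and sign conditions are dropped: uniqueness alone leaves at most one family
    per wedge.\<close>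
  let ?A = "\<lambda>g. {a. (\<Sum>i\<in>UNIV. a i *\<^sub>R fst (g i)) = q - p}"
  have "finite (?A g)" if "g \<in> W" for g
  proof (cases "?A g = {}")
    case False
    then obtain a where "a \<in> ?A g" by blast
    then have "?A g \<subseteq> {a}"
      using wedge_coeffs_unique[OF that] by auto
    then show ?thesis by (rule finite_subset) simp
  qed simp
  then have "finite (\<Union>g\<in>W. (\<lambda>a. \<Sum>i\<in>UNIV. a i * snd (g i)) ` ?A g)"
    using finite_wedges by blast
  then show ?thesis
    by (rule rev_finite_subset) (auto simp: wedge_costs_def)
qed

lemma wedge_costs_nonempty:
  assumes "q - p \<in> G"
  shows "wedge_costs p q \<noteq> {}"
proof -
  obtain g a where "g \<in> W" "\<forall>i. a i \<in> R \<and> 0 \<le> a i" "q - p = (\<Sum>i\<in>UNIV. a i *\<^sub>R fst (g i))"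
    using assms wedges unfolding organized_in_basis_wedges_def by blast
  then have "(\<Sum>i\<in>UNIV. a i * snd (g i)) \<in> wedge_costs p q"
    unfolding wedge_costs_def by auto
  then show ?thesis by blast
qed

lemma path_of_wedge_cost:
  assumes "c \<in> wedge_costs p q"
  obtains \<alpha> where "is_path R C p q \<alpha>" "path_cost C \<alpha> = c"
proof -
  obtain g a where g: "g \<in> W" and a: "\<And>i. a i \<in> R" "\<And>i. 0 \<le> a i"
    and sum: "(\<Sum>i\<in>UNIV. a i *\<^sub>R fst (g i)) = q - p" and c: "c = (\<Sum>i\<in>UNIV. a i * snd (g i))"
    using assms by (auto simp: wedge_costs_def)
  have "inj (fst \<circ> g)"
    using g wedges by (auto simp: organized_in_basis_wedges_def is_wedge_def)
  then have inj: "inj g" by (rule inj_on_imageI2)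
  have sub: "range g \<subseteq> C" using wedge_gen_mem[OF g] by auto
  \<comment> \<open>The wedge coefficients are extended by zero to the whole mask.\<close>
  define \<alpha> where "\<alpha> k = (if k \<in> range g then a (inv g k) else 0)" for k
  have "(\<Sum>k\<in>C. \<alpha> k *\<^sub>R fst k) = (\<Sum>k\<in>range g. \<alpha> k *\<^sub>R fst k)"
    using fin sub by (intro sum.mono_neutral_right) (auto simp: \<alpha>_def)
  also have "\<dots> = q - p"
    using inj sum by (simp add: sum.reindex \<alpha>_def)
  finally have "is_path R C p q \<alpha>"
    using a real_subring_zero[OF ring] by (auto simp: is_path_def \<alpha>_def)
  moreover have "path_cost C \<alpha> = (\<Sum>k\<in>range g. \<alpha> k * snd k)"
    unfolding path_cost_def using fin sub by (intro sum.mono_neutral_right) (auto simp: \<alpha>_def)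
  then have "path_cost C \<alpha> = c"
    using inj c by (simp add: sum.reindex \<alpha>_def)
  ultimately show ?thesis using that by blast
qed

text \<open>If the ray through the normalized endpoint meets a face at parameter \<open>t\<close>,
  that wedge reaches \<open>q\<close> at the cost divided by \<open>t\<close>, and
  \<open>1 \<le> t\<close>.\<close>

lemma wedge_cost_le_path_cost:
  assumes path: "is_path S C p q \<alpha>" and G: "q - p \<in> G"
  obtains c where "c \<in> wedge_costs p q" "c \<le> path_cost C \<alpha>"
proof (cases "p = q")
  case True
  \<comment> \<open>Normalizing would divide by a cost that may be zero, so zero coefficients on any
    wedge are used; covering \<open>q - p\<close> shows that one exists.\<close>
  obtain g where "g \<in> W"
    using wedges G unfolding organized_in_basis_wedges_def by blast
  then have "0 \<in> wedge_costs p q"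
    using True real_subring_zero[OF ring]
    unfolding wedge_costs_def by (intro CollectI exI[of _ g] exI[of _ "\<lambda>_. 0"]) simp
  then show ?thesis using that cost_nonneg[OF path] by blast
next
  case False
  let ?c = "path_cost C \<alpha>"
  have c: "0 < ?c"
    using cost_nonneg[OF path] cost_zero_imp_eq[OF path] False by force
  have "(1 / ?c) *\<^sub>R (q - p) \<noteq> 0"
    using c False by simp
  then obtain t where t: "1 \<le> t" "t *\<^sub>R (1 / ?c) *\<^sub>R (q - p) \<in> (\<Union>g\<in>W. wedge_face g)"
    using path_endpoint_mem_polytope[OF path False] ray_meets_of_mem_inside
    unfolding mask_polytope_def by meson
  then obtain g where g: "g \<in> W" "t *\<^sub>R (1 / ?c) *\<^sub>R (q - p) \<in> wedge_face g"
    by blast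
  then obtain b where b: "\<And>i. 0 \<le> b i" "sum b UNIV = 1"
    "t *\<^sub>R (1 / ?c) *\<^sub>R (q - p) = (\<Sum>i\<in>UNIV. b i *\<^sub>R ((1 / snd (g i)) *\<^sub>R fst (g i)))"
    unfolding wedge_face_def by (elim convex_hull_range_coeffs) blast
  \<comment> \<open>Both normalizations are undone: \<open>?c / t\<close> moves the face point back
    to \<open>q - p\<close>, and \<open>snd (g i)\<close> turns its vertices back into mask
    vectors.\<close>
  define a where "a i = ?c / t * (b i / snd (g i))" for i
  have pos: "0 < snd (g i)" for i
    using weight_pos[OF wedge_gen_mem[OF g(1)]] .
  have "q - p = (?c / t) *\<^sub>R (t *\<^sub>R (1 / ?c) *\<^sub>R (q - p))"
    using c t by simp
  also have "\<dots> = (\<Sum>i\<in>UNIV. a i *\<^sub>R fst (g i))"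
    unfolding b(3) by (simp add: a_def scaleR_sum_right)
  finally have sum: "(\<Sum>i\<in>UNIV. a i *\<^sub>R fst (g i)) = q - p" ..
  have "a i \<in> R" for i
    using wedge_coeffs_in_ring[OF g(1)] sum G by simp
  moreover have "0 \<le> a i" for i
    using c t(1) b(1)[of i] pos[of i] by (simp add: a_def)
  ultimately have "(\<Sum>i\<in>UNIV. a i * snd (g i)) \<in> wedge_costs p q"
    using g(1) sum unfolding wedge_costs_def by blast
  moreover have "(\<Sum>i\<in>UNIV. a i * snd (g i)) = (\<Sum>i\<in>UNIV. ?c / t * b i)"
    using pos by (intro sum.cong) (auto simp: a_def less_imp_neq[symmetric])
  then have "(\<Sum>i\<in>UNIV. a i * snd (g i)) = ?c / t"
    using b(2) by (simp only: sum_distrib_left[symmetric] mult_1_right)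
  moreover have "?c / t \<le> ?c"
    using c t(1) by (simp add: field_simps)
  ultimately show ?thesis using that by simp
qed

section \<open>Existence of the minimum\<close>

text \<open>The least wedge cost is attained over \<open>R\<close> and bounds all path costs from
  below, so \<open>LEAST\<close> is specified. The bound holds for every \<open>S\<close>, in
  particular for real coefficients.\<close>

lemma weighted_dist_attained:
  assumes "q - p \<in> G"
  obtains \<alpha> where "is_path R C p q \<alpha>" "path_cost C \<alpha> = weighted_dist R C p q"
    and "\<And>S \<beta>. is_path S C p q \<beta> \<Longrightarrow> weighted_dist R C p q \<le> path_cost C \<beta>"
proof -
  let ?m = "Min (wedge_costs p q)"
  have m: "?m \<in> wedge_costs p q"
    using finite_wedge_costs wedge_costs_nonempty[OF assms] by (rule Min_in)
  have le: "?m \<le> path_cost C \<beta>" if \<beta>: "is_path S C p q \<beta>" for S \<beta>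
  proof -
    obtain c where "c \<in> wedge_costs p q" "c \<le> path_cost C \<beta>"
      using \<beta> assms by (rule wedge_cost_le_path_cost)
    then show ?thesis
      using Min_le[OF finite_wedge_costs] order_trans by blast
  qed
  obtain \<alpha> where \<alpha>: "is_path R C p q \<alpha>" "path_cost C \<alpha> = ?m"
    using m by (rule path_of_wedge_cost)
  have "weighted_dist R C p q = ?m"
    unfolding weighted_dist_def
  proof (rule Least_equality)
    show "\<exists>\<alpha>. is_path R C p q \<alpha> \<and> ?m = path_cost C \<alpha>"
      using \<alpha> by auto
  qed (use le in blast)
  with \<alpha> le show ?thesis by (intro that[of \<alpha>]) simp_all
qed

lemma weighted_dist_le:
  assumes "q - p \<in> G" "is_path S C p q \<beta>"
  shows "weighted_dist R C p q \<le> path_cost C \<beta>"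
  using weighted_dist_attained[OF assms(1)] assms(2) by blast

section \<open>The norm axioms\<close>

lemma weighted_dist_nonneg: "q - p \<in> G \<Longrightarrow> 0 \<le> weighted_dist R C p q"
  using weighted_dist_attained cost_nonneg by metis

lemma weighted_dist_refl: "weighted_dist R C p p = 0"
proof -
  have "p - p \<in> G" using module by (simp add: real_submodule_def)
  moreover have "is_path UNIV C p p (\<lambda>_. 0)" by (simp add: is_path_def)
  ultimately show ?thesis
    using weighted_dist_le weighted_dist_nonneg by (fastforce simp: path_cost_def)
qed

lemma weighted_dist_eq_0_iff:
  assumes "q - p \<in> G"
  shows "weighted_dist R C p q = 0 \<longleftrightarrow> p = q"
  using weighted_dist_attained[OF assms] cost_zero_imp_eq weighted_dist_refl by metis

lemma weighted_dist_diff: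
  "q - p = q' - p' \<Longrightarrow> weighted_dist R C p q = weighted_dist R C p' q'"
  by (simp add: weighted_dist_def is_path_def)

text \<open>Negating vectors and keeping weights is an involution of \<open>C\<close>; reindexing
  along it reverses a path at equal cost.\<close>

lemma weighted_dist_commute_le:
  assumes "p - q \<in> G" "q - p \<in> G"
  shows "weighted_dist R C q p \<le> weighted_dist R C p q"
proof -
  obtain \<alpha> where \<alpha>: "is_path R C p q \<alpha>" "path_cost C \<alpha> = weighted_dist R C p q"
    using weighted_dist_attained[OF assms(2)] by metis
  let ?n = "\<lambda>(v, w). (- v, w) :: (real^'n) \<times> real"
  have n: "bij_betw ?n C C"
    by (rule bij_betw_byWitness[of _ ?n]) (auto intro: symm)
  have "(\<Sum>k\<in>C. \<alpha> (?n k) *\<^sub>R fst k) = - (\<Sum>k\<in>C. \<alpha> (?n k) *\<^sub>R fst (?n k))"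
    by (simp add: case_prod_unfold sum_negf)
  also have "\<dots> = - (\<Sum>k\<in>C. \<alpha> k *\<^sub>R fst k)"
    by (simp only: sum.reindex_bij_betw[OF n, of "\<lambda>k. \<alpha> k *\<^sub>R fst k"])
  finally have "is_path R C q p (\<lambda>k. \<alpha> (?n k))"
    using \<alpha>(1) by (auto simp: is_path_def dest: symm)
  moreover have "path_cost C (\<lambda>k. \<alpha> (?n k)) = (\<Sum>k\<in>C. \<alpha> (?n k) * snd (?n k))"
    by (simp add: path_cost_def case_prod_unfold)
  then have "path_cost C (\<lambda>k. \<alpha> (?n k)) = path_cost C \<alpha>"
    by (simp only: path_cost_def sum.reindex_bij_betw[OF n, of "\<lambda>k. \<alpha> k * snd k"])
  ultimately show ?thesis
    using weighted_dist_le[OF assms(1)] \<alpha>(2) by metis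
qed

lemma weighted_dist_commute:
  assumes "p - q \<in> G" "q - p \<in> G"
  shows "weighted_dist R C p q = weighted_dist R C q p"
  using assms by (intro antisym weighted_dist_commute_le)

text \<open>Adding coefficients concatenates optimal paths; the sum competes as a path over
  \<open>UNIV\<close>.\<close>

lemma weighted_dist_triangle:
  assumes "q - p \<in> G" "r - p \<in> G" "q - r \<in> G"
  shows "weighted_dist R C p q \<le> weighted_dist R C p r + weighted_dist R C r q"
proof -
  obtain \<alpha> where \<alpha>: "is_path R C p r \<alpha>" "path_cost C \<alpha> = weighted_dist R C p r"
    using weighted_dist_attained[OF assms(2)] by metis
  obtain \<beta> where \<beta>: "is_path R C r q \<beta>" "path_cost C \<beta> = weighted_dist R C r q"
    using weighted_dist_attained[OF assms(3)] by metis
  have "is_path UNIV C p q (\<lambda>k. \<alpha> k + \<beta> k)"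
    using \<alpha>(1) \<beta>(1) by (auto simp: is_path_def scaleR_add_left sum.distrib)
  from weighted_dist_le[OF assms(1) this] \<alpha>(2) \<beta>(2) show ?thesis
    by (simp add: path_cost_def distrib_right sum.distrib)
qed

text \<open>The factor \<open>c\<close> is any nonnegative real, so that the inverse of a ring
  element is allowed; the scaled path is one over \<open>UNIV\<close>.\<close>

lemma weighted_dist_scale_le:
  assumes "q - p \<in> G" "c *\<^sub>R (q - p) \<in> G" "0 \<le> c"
  shows "weighted_dist R C (c *\<^sub>R p) (c *\<^sub>R q) \<le> c * weighted_dist R C p q"
proof -
  obtain \<alpha> where \<alpha>: "is_path R C p q \<alpha>" "path_cost C \<alpha> = weighted_dist R C p q"
    using weighted_dist_attained[OF assms(1)] by metis
  have "(\<Sum>k\<in>C. (c * \<alpha> k) *\<^sub>R fst k) = c *\<^sub>R (\<Sum>k\<in>C. \<alpha> k *\<^sub>R fst k)"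
    by (simp add: scaleR_sum_right)
  then have "is_path UNIV C (c *\<^sub>R p) (c *\<^sub>R q) (\<lambda>k. c * \<alpha> k)"
    using \<alpha>(1) assms(3) by (auto simp: is_path_def scaleR_diff_right)
  moreover have "path_cost C (\<lambda>k. c * \<alpha> k) = c * path_cost C \<alpha>"
    by (simp add: path_cost_def sum_distrib_left mult.assoc)
  ultimately show ?thesis
    using weighted_dist_le[of "c *\<^sub>R q" "c *\<^sub>R p", folded scaleR_diff_right] assms(2) \<alpha>(2)
    by metis
qed

lemma weighted_dist_scale_pos:
  assumes "q - p \<in> G" "c *\<^sub>R (q - p) \<in> G" "0 < c"
  shows "weighted_dist R C (c *\<^sub>R p) (c *\<^sub>R q) = c * weighted_dist R C p q"
proof (rule antisym)
  \<comment> \<open>Scaling the scaled points back by \<open>1 / c\<close> gives the reverse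
    inequality.\<close>
  have "weighted_dist R C p q \<le> (1 / c) * weighted_dist R C (c *\<^sub>R p) (c *\<^sub>R q)"
    using weighted_dist_scale_le[of "c *\<^sub>R q" "c *\<^sub>R p" "1 / c", folded scaleR_diff_right] assms
    by simp
  then show "c * weighted_dist R C p q \<le> weighted_dist R C (c *\<^sub>R p) (c *\<^sub>R q)"
    using assms(3) by (simp add: field_simps)
qed (use weighted_dist_scale_le assms in simp)

lemma module_norm_weighted_dist: "module_norm R G (weighted_dist R C)"
proof -
  have diff: "\<And>p q. p \<in> G \<Longrightarrow> q \<in> G \<Longrightarrow> p - q \<in> G"
    and scale: "\<And>l p. l \<in> R \<Longrightarrow> p \<in> G \<Longrightarrow> l *\<^sub>R p \<in> G"
    using module by (auto simp: real_submodule_def)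
  have "weighted_dist R C (l *\<^sub>R p) (l *\<^sub>R q) = \<bar>l\<bar> * weighted_dist R C p q"
    if "p \<in> G" "q \<in> G" "l \<in> R" for p q l
  proof (cases l "0 :: real" rule: linorder_cases)
    case less
    \<comment> \<open>Swapping the endpoints absorbs the sign of \<open>l\<close>, since both pairs
      have the same displacement.\<close>
    have "weighted_dist R C (l *\<^sub>R p) (l *\<^sub>R q) = weighted_dist R C ((- l) *\<^sub>R q) ((- l) *\<^sub>R p)"
      by (rule weighted_dist_diff) simp
    also have "\<dots> = - l * weighted_dist R C q p"
      using that less
      by (intro weighted_dist_scale_pos scale diff real_subring_uminus[OF ring]) simp_all
    finally show ?thesis
      using less weighted_dist_commute diff that by simp
  next
    case equal
    then show ?thesis by (simp add: weighted_dist_refl)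
  next
    case greater
    then show ?thesis
      using that diff scale weighted_dist_scale_pos by simp
  qed
  then show ?thesis
    unfolding module_norm_def
    by (intro conjI ballI weighted_dist_nonneg weighted_dist_eq_0_iff weighted_dist_commute
        weighted_dist_triangle diff)
qed

end

theorem theorem2p3:
  fixes R :: "real set"
    and G :: "(real^'n) set"
    and C :: "((real^'n) \<times> real) set"
  assumes "real_subring R"
    and "real_submodule R G"
    and "restricted_chamfer_mask R G C"
  shows "module_norm R G (weighted_dist R C)"
proof -
  obtain W where "organized_in_basis_wedges R G C W" "convex (mask_polytope W)"
    using assms(3) by (auto simp: restricted_chamfer_mask_def)
  then interpret organized_mask R G C W
    using assms by unfold_locales (auto simp: restricted_chamfer_mask_def)
  show ?thesis by (rule module_norm_weighted_dist)
qed

end
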